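(* Let $\mathcal{L}$ be an orthomodular lattice, let $\mathcal{L}^\Diamond$ be a modal extension of $\mathcal{L}$, and let $p\in\mathcal{L}$ with $p\notin Z(\mathcal{L})$. Let $W$ be a Boolean subalgebra of $\mathcal{L}$ with $p\in W$, and let $W^\Diamond=\langle W\cup Z(\mathcal{L}^\Diamond)\rangle_{\mathcal{L}^\Diamond}$ be the associated classically expanded context. Below, a valuation means a Boolean homomorphism $v:W^\Diamond\to\mathbf{2}$. Then: (1) (Contraries) There is no valuation $v$ with $v(\neg\Diamond\neg p)=v(\neg\Diamond p)=1$, and there exists a valuation $v$ with $v(\neg\Diamond\neg p)=v(\neg\Diamond p)=0$. (2) (Subcontraries) There is no valuation $v$ with $v(\Diamond p)=v(\Diamond\neg p)=0$, and there exists a valuation $v$ with $v(\Diamond p)=v(\Diamond\neg p)=1$. (3) (Subalterns) For every valuation $v$: if $v(\neg\Diamond\neg p)=1$ then $v(\Diamond p)=1$, and if $v(\Diamond p)=0$ then $v(\neg\Diamond\neg p)=0$; likewise, if $v(\neg\Diamond p)=1$ then $v(\Diamond\neg p)=1$, and if $v(\Diamond\neg p)=0$ then $v(\neg\Diamond p)=0$. (4) (Contradictories) For every valuation $v$, exactly one of $v(\Diamond p)$, $v(\neg\Diamond p)$ equals $1$ (the other being $0$), and exactly one of $v(\neg\Diamond\neg p)$, $v(\Diamond\neg p)$ equals $1$ (the other being $0$).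
   Context: An orthomodular lattice is an algebra $\langle L,\land,\lor,\neg,0,1\rangle$ that is a bounded lattice with an involution $\neg$ (i.e. $\neg\neg x=x$ and $\neg(x\lor y)=\neg x\land\neg y$) such that $x\land\neg x=0$ and $x\lor(\neg x\land(x\lor y))=x\lor y$. Boolean algebras are the distributive orthomodular lattices; $\mathbf{2}$ is the two-element Boolean algebra. In a bounded lattice $L$, an element $z$ is central iff it has a complement and, for all $a,b\in L$, both $(x_1\lor x_2)\land x_3=(x_1\land x_3)\lor(x_2\land x_3)$ and $(x_1\land x_2)\lor x_3=(x_1\lor x_3)\land(x_2\lor x_3)$ hold for every permutation $(x_1,x_2,x_3)$ of $(a,b,z)$. The set of central elements, the center, is denoted $Z(L)$; it is a Boolean sublattice of $L$. A Boolean saturated orthomodular lattice is an orthomodular lattice $M$ in which, for every $a\in M$, the minimum $\Diamond a=\min\{z\in Z(M): a\le z\}$ exists; $M$ is then equipped with the unary operation $\Diamond$. The class of these algebras is denoted $\mathcal{OML}^\Diamond$. A modal extension of an orthomodular lattice $\mathcal{L}$ is an $\mathcal{L}^\Diamond\in\mathcal{OML}^\Diamond$ in which $\mathcal{L}$ is embedded as an orthomodular lattice; $\mathcal{L}$ is regarded as a subset (a subalgebra for $\land,\lor,\neg,0,1$) of $\mathcal{L}^\Diamond$, and $\Diamond p$, for $p\in\mathcal{L}$, is computed in $\mathcal{L}^\Diamond$. For a subset $A$ of a lattice $M$, $\langle A\rangle_M$ denotes the sublattice of $M$ generated by $A$. For a Boolean subalgebra $W$ of $\mathcal{L}$, the lattice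 $W^\Diamond=\langle W\cup Z(\mathcal{L}^\Diamond)\rangle_{\mathcal{L}^\Diamond}$ is a Boolean subalgebra of $\mathcal{L}^\Diamond$, called a classically expanded context. *)

theory Defs
  imports HOL.Hull "HOL-Library.Complemented_Lattices" "HOL-Library.Multiset"
begin

unbundle lattice_syntax

text \<open>
  Orthomodular lattices are the library class \<^class>\<open>orthomodular_lattice\<close>, with \<^const>\<open>uminus\<close>
  as the involution. The binary difference in that class is determined by the other operations.
\<close>

context bounded_lattice
begin

definition is_complement :: "'a \<Rightarrow> 'a \<Rightarrow> bool" where
  "is_complement x y \<longleftrightarrow> x \<sqinter> y = \<bottom> \<and> x \<squnion> y = \<top>"

text \<open>Equality of the two lists up to reordering says that \<open>(x1, x2, x3)\<close> is a permutation of
  \<open>(a, b, z)\<close>.\<close>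

definition center :: "'a set" where
  "center = {z. (\<exists>z'. is_complement z z') \<and>
     (\<forall>a b x1 x2 x3. mset [x1, x2, x3] = mset [a, b, z] \<longrightarrow>
        (x1 \<squnion> x2) \<sqinter> x3 = (x1 \<sqinter> x3) \<squnion> (x2 \<sqinter> x3) \<and>
        (x1 \<sqinter> x2) \<squnion> x3 = (x1 \<squnion> x3) \<sqinter> (x2 \<squnion> x3))}"

end

class boolean_saturated_oml = orthomodular_lattice +
  fixes diamond :: "'a \<Rightarrow> 'a"
  assumes diamond_central: "diamond a \<in> center"
    and diamond_upper: "a \<le> diamond a"
    and diamond_least: "z \<in> center \<Longrightarrow> a \<le> z \<Longrightarrow> diamond a \<le> z"

definition oml_embedding :: "('a::orthomodular_lattice \<Rightarrow> 'b::orthomodular_lattice) \<Rightarrow> bool" where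
  "oml_embedding f \<longleftrightarrow> inj f \<and>
     (\<forall>x y. f (x \<sqinter> y) = f x \<sqinter> f y) \<and> (\<forall>x y. f (x \<squnion> y) = f x \<squnion> f y) \<and>
     (\<forall>x. f (- x) = - f x) \<and> f \<bottom> = \<bottom> \<and> f \<top> = \<top>"

definition sublattice :: "'a::lattice set \<Rightarrow> bool" where
  "sublattice S \<longleftrightarrow> (\<forall>x\<in>S. \<forall>y\<in>S. x \<sqinter> y \<in> S \<and> x \<squnion> y \<in> S)"

definition boolean_subalgebra :: "'a::orthomodular_lattice set \<Rightarrow> bool" where
  "boolean_subalgebra W \<longleftrightarrow>
     sublattice W \<and> (\<forall>x\<in>W. - x \<in> W) \<and> \<bottom> \<in> W \<and> \<top> \<in> W \<and>
     (\<forall>x\<in>W. \<forall>y\<in>W. \<forall>z\<in>W. x \<sqinter> (y \<squnion> z) = (x \<sqinter> y) \<squnion> (x \<sqinter> z))"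

definition expanded_context ::
    "('a::orthomodular_lattice \<Rightarrow> 'b::boolean_saturated_oml) \<Rightarrow> 'a set \<Rightarrow> 'b set" where
  "expanded_context \<iota> W = sublattice hull (\<iota> ` W \<union> center)"

text \<open>The two-element Boolean algebra is \<^typ>\<open>bool\<close>. Only the values of \<open>v\<close> on \<open>B\<close> are relevant.\<close>

definition valuation :: "'a::orthomodular_lattice set \<Rightarrow> ('a \<Rightarrow> bool) \<Rightarrow> bool" where
  "valuation B v \<longleftrightarrow>
     (\<forall>x\<in>B. \<forall>y\<in>B. v (x \<sqinter> y) = (v x \<sqinter> v y) \<and> v (x \<squnion> y) = (v x \<squnion> v y)) \<and>
     (\<forall>x\<in>B. v (- x) = (- v x)) \<and> v \<bottom> = \<bottom> \<and> v \<top> = \<top>"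

end

theory Submission
  imports Defs
begin

text \<open>
  An expanded context is generated by pairwise commuting elements, hence by the Foulis--Holland
  theorem it is a Boolean subalgebra. If \<open>\<Diamond>p \<sqinter> \<Diamond>(- p)\<close> were \<open>\<bottom>\<close>, then
  \<open>- p \<le> \<Diamond>(- p) \<le> - \<Diamond>p\<close> would give \<open>\<Diamond>p = p\<close>, making \<open>p\<close> central in the
  extension and therefore in the original lattice. So some ultrafilter of the expanded context
  contains \<open>\<Diamond>p \<sqinter> \<Diamond>(- p)\<close>; this is the valuation witnessing both existence
  claims. The other claims only use \<open>- \<Diamond>(- p) \<le> p \<le> \<Diamond>p\<close>.
\<close>

section \<open>Commutation in orthomodular lattices and the Foulis-Holland theorem\<close>

definition commutes :: "'a::orthomodular_lattice \<Rightarrow> 'a \<Rightarrow> bool" where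
  "commutes x y \<longleftrightarrow> x = (x \<sqinter> y) \<squnion> (x \<sqinter> - y)"

lemma commutes_compl: "commutes x y \<Longrightarrow> commutes x (- y)"
  by (simp add: commutes_def sup_commute)

text \<open>De Morgan and absorption reduce \<open>y \<sqinter> - x\<close> to
  \<open>- (x \<sqinter> y) \<sqinter> y\<close>, and this is exactly the remainder that the
  orthomodular law supplies for \<open>x \<sqinter> y \<le> y\<close>.\<close>

lemma commutes_sym:
  assumes "commutes x y"
  shows "commutes y x"
proof -
  have "- x = - ((x \<sqinter> y) \<squnion> (x \<sqinter> - y))"
    using assms by (simp add: commutes_def)
  also have "\<dots> = (- x \<squnion> - y) \<sqinter> (- x \<squnion> y)"
    by simp
  finally have "y \<sqinter> - x = y \<sqinter> ((- x \<squnion> - y) \<sqinter> (- x \<squnion> y))"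
    by simp
  also have "\<dots> = (- x \<squnion> - y) \<sqinter> (y \<sqinter> (- x \<squnion> y))"
    by (simp add: inf_left_commute)
  also have "y \<sqinter> (- x \<squnion> y) = y"
    by (simp add: inf_absorb1)
  finally have "y \<sqinter> - x = - (x \<sqinter> y) \<sqinter> y"
    by simp
  moreover have "(x \<sqinter> y) \<squnion> (- (x \<sqinter> y) \<sqinter> y) = y"
    by (rule orthomodular) simp
  ultimately show ?thesis
    by (simp add: commutes_def inf_commute)
qed

lemma commutes_compl_left: "commutes x y \<Longrightarrow> commutes (- x) y"
  by (blast intro: commutes_sym commutes_compl)

text \<open>The left side is the Sasaki projection of \<open>y\<close> to \<open>x\<close>. Symmetry
  of commutation gives the dual decomposition
  \<open>y = (y \<squnion> - x) \<sqinter> (y \<squnion> x)\<close>, whose second factor is absorbed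
  by \<open>x\<close>.\<close>

lemma commutes_inf_sup_compl:
  assumes "commutes x y"
  shows "x \<sqinter> (- x \<squnion> y) = x \<sqinter> y"
proof -
  have "commutes (- y) x"
    using assms by (blast intro: commutes_sym commutes_compl)
  then have "- y = (- y \<sqinter> x) \<squnion> (- y \<sqinter> - x)"
    by (simp add: commutes_def)
  then have "- (- y) = - ((- y \<sqinter> x) \<squnion> (- y \<sqinter> - x))"
    by simp
  then have "y = (y \<squnion> - x) \<sqinter> (y \<squnion> x)"
    by simp
  then have "x \<sqinter> y = x \<sqinter> ((y \<squnion> - x) \<sqinter> (y \<squnion> x))"
    by simp
  also have "\<dots> = (- x \<squnion> y) \<sqinter> (x \<sqinter> (y \<squnion> x))"
    by (simp only: ac_simps)
  also have "x \<sqinter> (y \<squnion> x) = x"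
    by (simp add: inf_absorb1)
  finally show ?thesis
    by (simp add: inf_commute)
qed

text \<open>Since \<open>?r \<le> ?l\<close> always holds, orthomodularity yields equality once
  \<open>- ?r \<sqinter> ?l\<close> is \<open>\<bottom>\<close>. Commutation turns the two factors
  coming from \<open>- ?r\<close> into \<open>x \<sqinter> - y\<close> and
  \<open>x \<sqinter> - z\<close>, and their meet is disjoint from
  \<open>y \<squnion> z\<close>.\<close>

theorem foulis_holland:
  assumes "commutes x y" and "commutes x z"
  shows "x \<sqinter> (y \<squnion> z) = (x \<sqinter> y) \<squnion> (x \<sqinter> z)"
proof -
  let ?l = "x \<sqinter> (y \<squnion> z)" and ?r = "(x \<sqinter> y) \<squnion> (x \<sqinter> z)"
  have "- ?r \<sqinter> ?l = (y \<squnion> z) \<sqinter> ((x \<sqinter> (- x \<squnion> - y)) \<sqinter> (x \<sqinter> (- x \<squnion> - z)))"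
    by (simp add: inf_commute inf_left_commute inf_assoc)
  also have "\<dots> = (y \<squnion> z) \<sqinter> ((x \<sqinter> - y) \<sqinter> (x \<sqinter> - z))"
    using assms by (simp add: commutes_inf_sup_compl commutes_compl)
  also have "\<dots> = x \<sqinter> ((y \<squnion> z) \<sqinter> - (y \<squnion> z))"
    by (simp add: inf_commute inf_left_commute inf_assoc)
  also have "\<dots> = \<bottom>"
    by (simp only: inf_compl_bot inf_bot_right)
  finally have "- ?r \<sqinter> ?l = \<bottom>" .
  moreover have "?r \<le> ?l"
    by (simp add: le_infI2)
  ultimately show ?thesis
    using orthomodular[of ?r ?l] by simp
qed

lemma commutes_sup:
  assumes "commutes x y" and "commutes x z"
  shows "commutes x (y \<squnion> z)"
proof -
  have "commutes (y \<squnion> z) x"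
  proof -
    have "y = (y \<sqinter> x) \<squnion> (y \<sqinter> - x)" "z = (z \<sqinter> x) \<squnion> (z \<sqinter> - x)"
      using assms[THEN commutes_sym] by (simp_all add: commutes_def)
    \<comment> \<open>The four pieces of \<open>y\<close> and \<open>z\<close> are regrouped by
      their side of \<open>x\<close>, so that distributivity applies once for \<open>x\<close> and
      once for \<open>- x\<close>.\<close>
    then have "y \<squnion> z = ((x \<sqinter> y) \<squnion> (x \<sqinter> z)) \<squnion> ((- x \<sqinter> y) \<squnion> (- x \<sqinter> z))"
      by (metis inf_commute sup_assoc sup_left_commute)
    also have "\<dots> = (x \<sqinter> (y \<squnion> z)) \<squnion> (- x \<sqinter> (y \<squnion> z))"
      using assms by (simp add: foulis_holland commutes_compl_left)
    finally show ?thesis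
      by (simp add: commutes_def inf_commute)
  qed
  then show ?thesis by (rule commutes_sym)
qed

lemma commutes_inf:
  assumes "commutes x y" and "commutes x z"
  shows "commutes x (y \<sqinter> z)"
  using commutes_compl[OF commutes_sup[OF assms[THEN commutes_compl]]] by simp

section \<open>Central elements\<close>

lemma center_sup_inf_distrib:
  assumes "z \<in> center"
  shows "a \<sqinter> (z \<squnion> b) = (a \<sqinter> z) \<squnion> (a \<sqinter> b)"
proof -
  have "mset [z, b, a] = mset [a, b, z]"
    by simp
  then have "(z \<squnion> b) \<sqinter> a = (z \<sqinter> a) \<squnion> (b \<sqinter> a)"
    using assms unfolding center_def by blast
  then show ?thesis by (simp add: inf_commute)
qed

lemma center_commutes: "z \<in> center \<Longrightarrow> commutes a z"
  using center_sup_inf_distrib[of z a "- z"] by (simp add: commutes_def)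

text \<open>Complementation exchanges the two distributive laws, so each law for a triple containing
  \<open>- z\<close> is the complement of the other law for a triple containing
  \<open>z\<close>.\<close>

lemma center_compl:
  fixes z :: "'a::orthomodular_lattice"
  assumes "z \<in> center"
  shows "- z \<in> center"
  unfolding center_def
proof (intro CollectI conjI allI impI)
  show "\<exists>z'. is_complement (- z) z'"
    by (rule exI[of _ z]) (simp add: is_complement_def)
next
  fix a b x y w :: 'a
  assume "mset [x, y, w] = mset [a, b, - z]"
  \<comment> \<open>Negating all entries keeps the permutation condition and moves \<open>z\<close>
    itself into the triple.\<close>
  then have "image_mset uminus (mset [x, y, w]) = image_mset uminus (mset [a, b, - z])"
    by (rule arg_cong)
  then have "mset [- x, - y, - w] = mset [- a, - b, z]"
    by simp
  then have *: "(- x \<squnion> - y) \<sqinter> - w = (- x \<sqinter> - w) \<squnion> (- y \<sqinter> - w)"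
    "(- x \<sqinter> - y) \<squnion> - w = (- x \<squnion> - w) \<sqinter> (- y \<squnion> - w)"
    using assms unfolding center_def by blast+
  show "(x \<squnion> y) \<sqinter> w = (x \<sqinter> w) \<squnion> (y \<sqinter> w)"
    using arg_cong[OF *(2), of uminus] by simp
  show "(x \<sqinter> y) \<squnion> w = (x \<squnion> w) \<sqinter> (y \<squnion> w)"
    using arg_cong[OF *(1), of uminus] by simp
qed

text \<open>Both laws are lattice equations: they hold for the images of any triple containing
  \<open>z\<close>, and injectivity pulls them back.\<close>

lemma oml_embedding_center_reflect:
  fixes f :: "'a::orthomodular_lattice \<Rightarrow> 'b::orthomodular_lattice"
  assumes f: "oml_embedding f" and z: "f z \<in> center"
  shows "z \<in> center"
  unfolding center_def
proof (intro CollectI conjI allI impI)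
  show "\<exists>z'. is_complement z z'"
    by (rule exI[of _ "- z"]) (simp add: is_complement_def)
next
  fix a b x y w :: 'a
  assume "mset [x, y, w] = mset [a, b, z]"
  then have "image_mset f (mset [x, y, w]) = image_mset f (mset [a, b, z])"
    by (rule arg_cong)
  then have "mset [f x, f y, f w] = mset [f a, f b, f z]"
    by simp
  then have "(f x \<squnion> f y) \<sqinter> f w = (f x \<sqinter> f w) \<squnion> (f y \<sqinter> f w)"
    "(f x \<sqinter> f y) \<squnion> f w = (f x \<squnion> f w) \<sqinter> (f y \<squnion> f w)"
    using z unfolding center_def by blast+
  then have "f ((x \<squnion> y) \<sqinter> w) = f ((x \<sqinter> w) \<squnion> (y \<sqinter> w))"
    "f ((x \<sqinter> y) \<squnion> w) = f ((x \<squnion> w) \<sqinter> (y \<squnion> w))"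
    using f by (simp_all add: oml_embedding_def)
  moreover have "inj f"
    using f by (simp add: oml_embedding_def)
  ultimately show "(x \<squnion> y) \<sqinter> w = (x \<sqinter> w) \<squnion> (y \<sqinter> w)"
    "(x \<sqinter> y) \<squnion> w = (x \<squnion> w) \<sqinter> (y \<squnion> w)"
    by (blast dest: injD)+
qed

section \<open>Boolean subalgebras generated by commuting elements\<close>

lemma boolean_subalgebra_commutes:
  assumes "boolean_subalgebra W" and "x \<in> W" and "y \<in> W"
  shows "commutes x y"
proof -
  have "x \<sqinter> (y \<squnion> - y) = (x \<sqinter> y) \<squnion> (x \<sqinter> - y)"
    using assms unfolding boolean_subalgebra_def by blast
  then show ?thesis
    by (simp add: commutes_def)
qed

lemma oml_embedding_commutes:
  assumes f: "oml_embedding f" and xy: "commutes x y"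
  shows "commutes (f x) (f y)"
proof -
  have "f x = f ((x \<sqinter> y) \<squnion> (x \<sqinter> - y))"
    using xy by (simp add: commutes_def)
  then show ?thesis
    using f by (simp add: commutes_def oml_embedding_def)
qed

lemma sublattice_hull: "sublattice (sublattice hull S)"
  by (rule hull_in) (auto simp: sublattice_def)

lemma sublattice_commutant: "sublattice {y. commutes x y}"
  by (auto simp: sublattice_def intro: commutes_sup commutes_inf)

text \<open>The elements commuting with a fixed one form a sublattice, so hull induction applies
  twice: first with a generator fixed, then, after symmetry, with the hull element \<open>x\<close>
  fixed.\<close>

lemma sublattice_hull_commutes:
  assumes "\<And>x y. x \<in> S \<Longrightarrow> y \<in> S \<Longrightarrow> commutes x y"
    and x: "x \<in> sublattice hull S" and y: "y \<in> sublattice hull S"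
  shows "commutes x y"
proof -
  have "commutes s x" if "s \<in> S" for s
    using x by (rule hull_induct) (auto intro: assms(1) that sublattice_commutant)
  then have "commutes x s" if "s \<in> S" for s
    using that by (blast intro: commutes_sym)
  with y show ?thesis
    by (rule hull_induct) (auto intro: sublattice_commutant)
qed

text \<open>By De Morgan, the elements whose complement lies in the hull form a sublattice;
  distributivity is the Foulis-Holland theorem, as all hull elements commute.\<close>

lemma boolean_subalgebra_hull:
  assumes comm: "\<And>x y. x \<in> S \<Longrightarrow> y \<in> S \<Longrightarrow> commutes x y"
    and compl: "\<And>x. x \<in> S \<Longrightarrow> - x \<in> S"
    and "\<bottom> \<in> S" and "\<top> \<in> S"
  shows "boolean_subalgebra (sublattice hull S)"
  unfolding boolean_subalgebra_def
proof (intro conjI ballI)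
  show "sublattice (sublattice hull S)"
    by (rule sublattice_hull)
  show "- x \<in> sublattice hull S" if "x \<in> sublattice hull S" for x
    using that
  proof (rule hull_induct)
    show "sublattice {x. - x \<in> sublattice hull S}"
      using sublattice_hull[of S] unfolding sublattice_def by simp
  qed (simp add: compl hull_inc)
  show "\<bottom> \<in> sublattice hull S" "\<top> \<in> sublattice hull S"
    using assms by (simp_all add: hull_inc)
  show "x \<sqinter> (y \<squnion> z) = (x \<sqinter> y) \<squnion> (x \<sqinter> z)"
    if "x \<in> sublattice hull S" "y \<in> sublattice hull S" "z \<in> sublattice hull S" for x y z
    using that by (simp add: foulis_holland sublattice_hull_commutes[OF comm])
qed

text \<open>Generators commute pairwise: central ones commute with everything, and those from
  \<open>W\<close> inherit commutation through the embedding.\<close>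

lemma boolean_subalgebra_expanded_context:
  assumes f: "oml_embedding f" and W: "boolean_subalgebra W"
  shows "boolean_subalgebra (expanded_context f W)"
  unfolding expanded_context_def
proof (rule boolean_subalgebra_hull)
  show "commutes x y" if "x \<in> f ` W \<union> center" "y \<in> f ` W \<union> center" for x y
    using that f W
    by (blast intro: center_commutes commutes_sym oml_embedding_commutes
        boolean_subalgebra_commutes)
  have "- f x \<in> f ` W" if "x \<in> W" for x
  proof -
    have "- f x = f (- x)"
      using f by (simp add: oml_embedding_def)
    then show ?thesis
      using W that by (auto simp: boolean_subalgebra_def)
  qed
  then show "- x \<in> f ` W \<union> center" if "x \<in> f ` W \<union> center" for x
    using that by (auto intro: center_compl)
  have "f \<bottom> \<in> f ` W" "f \<top> \<in> f ` W"
    using W by (simp_all add: boolean_subalgebra_def)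
  then show "\<bottom> \<in> f ` W \<union> center" "\<top> \<in> f ` W \<union> center"
    using f by (simp_all add: oml_embedding_def)
qed

section \<open>Existence of valuations\<close>

text \<open>The Boolean ultrafilter theorem relative to \<open>B\<close>: Zorn's lemma gives a
  maximal proper filter containing \<open>q\<close>, and membership in it is the valuation.\<close>

lemma valuation_exists:
  fixes B :: "'a::orthomodular_lattice set"
  assumes B: "boolean_subalgebra B" and q: "q \<in> B" "q \<noteq> \<bottom>"
  shows "\<exists>v. valuation B v \<and> v q"
proof -
  have B_inf: "x \<sqinter> y \<in> B" and B_sup: "x \<squnion> y \<in> B" if "x \<in> B" "y \<in> B" for x y
    using B that by (auto simp: boolean_subalgebra_def sublattice_def)
  have B_compl: "- x \<in> B" if "x \<in> B" for x
    using B that by (auto simp: boolean_subalgebra_def)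
  have B_top: "\<top> \<in> B"
    using B by (simp add: boolean_subalgebra_def)
  \<comment> \<open>The proper filters of \<open>B\<close> that contain \<open>q\<close>.\<close>
  define \<A> where "\<A> = {F. F \<subseteq> B \<and> q \<in> F \<and> \<bottom> \<notin> F \<and> (\<forall>x\<in>F. \<forall>y\<in>F. x \<sqinter> y \<in> F)
    \<and> (\<forall>x\<in>F. \<forall>y\<in>B. x \<le> y \<longrightarrow> y \<in> F)}"
  have "\<exists>M\<in>\<A>. \<forall>X\<in>\<A>. M \<subseteq> X \<longrightarrow> X = M"
  proof (rule subset_Zorn_nonempty)
    have "{y \<in> B. q \<le> y} \<in> \<A>"
      using q B_inf by (auto simp: \<A>_def bot_unique)
    then show "\<A> \<noteq> {}" by blast
  next
    fix \<C> assume "\<C> \<noteq> {}" and chain: "subset.chain \<A> \<C>"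
    have sub: "F \<in> \<A>" if "F \<in> \<C>" for F
      using chain that by (auto simp: subset.chain_def)
    have "x \<sqinter> y \<in> \<Union>\<C>" if xy: "x \<in> \<Union>\<C>" "y \<in> \<Union>\<C>" for x y
    proof -
      obtain F G where FG: "F \<in> \<C>" "G \<in> \<C>" "x \<in> F" "y \<in> G"
        using xy by blast
      then have "F \<subseteq> G \<or> G \<subseteq> F"
        using chain by (auto simp: subset.chain_def)
      then obtain H where "H \<in> \<C>" "x \<in> H" "y \<in> H"
        using FG by blast
      moreover from this have "x \<sqinter> y \<in> H"
        using sub[of H] by (simp add: \<A>_def)
      ultimately show ?thesis by blast
    qed
    moreover have "F \<subseteq> B" "q \<in> F" "\<bottom> \<notin> F" if "F \<in> \<C>" for F
      using sub[OF that] by (simp_all add: \<A>_def)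
    then have "\<Union>\<C> \<subseteq> B" "q \<in> \<Union>\<C>" "\<bottom> \<notin> \<Union>\<C>"
      using \<open>\<C> \<noteq> {}\<close> by blast+
    moreover have "y \<in> \<Union>\<C>" if xy: "x \<in> \<Union>\<C>" "y \<in> B" "x \<le> y" for x y
    proof -
      obtain F where "F \<in> \<C>" "x \<in> F"
        using xy by blast
      moreover from this have "y \<in> F"
        using sub[of F] xy by (simp add: \<A>_def)
      ultimately show ?thesis by blast
    qed
    ultimately show "\<Union>\<C> \<in> \<A>"
      by (simp add: \<A>_def)
  qed
  then obtain F where F: "F \<in> \<A>" and maximal: "\<And>X. X \<in> \<A> \<Longrightarrow> F \<subseteq> X \<Longrightarrow> X = F"
    by blast
  have FB: "F \<subseteq> B" and qF: "q \<in> F" and botF: "\<bottom> \<notin> F"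
    and F_inf: "\<And>x y. x \<in> F \<Longrightarrow> y \<in> F \<Longrightarrow> x \<sqinter> y \<in> F"
    and F_up: "\<And>x y. x \<in> F \<Longrightarrow> y \<in> B \<Longrightarrow> x \<le> y \<Longrightarrow> y \<in> F"
    using F by (auto simp: \<A>_def)
  have compl_mem: "- x \<in> F" if xB: "x \<in> B" and xF: "x \<notin> F" for x
  proof -
    \<comment> \<open>The filter of \<open>B\<close> generated by \<open>F\<close> and
      \<open>x\<close>. Maximality of \<open>F\<close> excludes it from \<open>\<A>\<close>, and the
      only condition that can fail is properness.\<close>
    define G where "G = {y \<in> B. \<exists>f\<in>F. f \<sqinter> x \<le> y}"
    have "F \<subseteq> G"
      using FB by (auto simp: G_def intro: le_infI1)
    moreover have "x \<in> G"
      using xB qF by (auto simp: G_def)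
    ultimately have "G \<notin> \<A>"
      using maximal xF by blast
    have "y \<sqinter> z \<in> G" if yz: "y \<in> G" "z \<in> G" for y z
    proof -
      obtain f g where fg: "f \<in> F" "g \<in> F" "f \<sqinter> x \<le> y" "g \<sqinter> x \<le> z"
        using yz by (auto simp: G_def)
      have "(f \<sqinter> g) \<sqinter> x = (f \<sqinter> x) \<sqinter> (g \<sqinter> x)"
        by (simp add: inf_commute inf_left_commute inf_assoc)
      also have "\<dots> \<le> y \<sqinter> z"
        using fg by (intro inf_mono)
      finally show ?thesis
        using fg yz F_inf B_inf by (auto simp: G_def)
    qed
    moreover have "z \<in> G" if "y \<in> G" "z \<in> B" "y \<le> z" for y z
      using that by (auto simp: G_def intro: order_trans)
    moreover have "G \<subseteq> B" "q \<in> G"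
      using \<open>F \<subseteq> G\<close> qF by (auto simp: G_def)
    ultimately have "\<bottom> \<in> G"
      using \<open>G \<notin> \<A>\<close> unfolding \<A>_def by blast
    then obtain f where f: "f \<in> F" "f \<sqinter> x = \<bottom>"
      by (auto simp: G_def bot_unique)
    \<comment> \<open>Disjointness alone does not give \<open>f \<le> - x\<close> in an orthomodular
      lattice; commutation inside \<open>B\<close> does.\<close>
    have "commutes f x"
      using B FB f xB by (auto intro: boolean_subalgebra_commutes)
    then have "f = f \<sqinter> - x"
      using f by (simp add: commutes_def)
    then have "f \<le> - x"
      by (rule inf.orderI)
    then show ?thesis
      using F_up[OF f(1) B_compl[OF xB]] by simp
  qed
  have compl_iff: "- x \<in> F \<longleftrightarrow> x \<notin> F" if "x \<in> B" for x
    using compl_mem[OF that] F_inf[of x "- x"] botF by auto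
  have inf_iff: "x \<sqinter> y \<in> F \<longleftrightarrow> x \<in> F \<and> y \<in> F" if "x \<in> B" "y \<in> B" for x y
    using that F_inf[of x y] F_up[of "x \<sqinter> y" x] F_up[of "x \<sqinter> y" y] by auto
  \<comment> \<open>Joins are reduced to complements and meets by De Morgan.\<close>
  have sup_iff: "x \<squnion> y \<in> F \<longleftrightarrow> x \<in> F \<or> y \<in> F" if "x \<in> B" "y \<in> B" for x y
    using that compl_iff[of "x \<squnion> y"] compl_iff[of x] compl_iff[of y] inf_iff[of "- x" "- y"]
    by (auto simp: B_compl B_sup)
  have "\<top> \<in> F"
    using F_up[OF qF B_top] by simp
  then have "valuation B (\<lambda>x. x \<in> F)"
    using botF by (simp add: valuation_def compl_iff inf_iff sup_iff)
  then show ?thesis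
    using qF by blast
qed

section \<open>The modal operator and the square of opposition\<close>

lemma diamond_inf_diamond_compl_ne_bot:
  assumes "a \<notin> center"
  shows "diamond a \<sqinter> diamond (- a) \<noteq> \<bottom>"
proof
  assume bot: "diamond a \<sqinter> diamond (- a) = \<bottom>"
  \<comment> \<open>Centrality is what upgrades the assumed disjointness to orthogonality.\<close>
  have "commutes (diamond (- a)) (diamond a)"
    by (intro center_commutes diamond_central)
  then have "diamond (- a) = diamond (- a) \<sqinter> - diamond a"
    using bot by (simp add: commutes_def inf_commute)
  then have "diamond (- a) \<le> - diamond a"
    by (rule inf.orderI)
  then have "- a \<le> - diamond a"
    using diamond_upper[of "- a"] by (rule order_trans[rotated])
  then have "diamond a = a"
    using diamond_upper[of a] by (simp add: order_antisym)
  then show False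
    using assms diamond_central[of a] by simp
qed

lemma valuation_mono:
  assumes "valuation B v" and "x \<in> B" and "y \<in> B" and "x \<le> y" and "v x"
  shows "v y"
proof -
  have "v (x \<sqinter> y) = (v x \<sqinter> v y)"
    using assms(1-3) by (simp add: valuation_def)
  then show ?thesis
    using assms(4,5) by (simp add: inf_absorb1)
qed

theorem mainTheorem1:
  fixes \<iota> :: "'a::orthomodular_lattice \<Rightarrow> 'b::boolean_saturated_oml"
    and p :: 'a and W :: "'a set"
  assumes "oml_embedding \<iota>"
    and "p \<notin> center"
    and "boolean_subalgebra W"
    and "p \<in> W"
  shows
    "((\<not> (\<exists>v. valuation (expanded_context \<iota> W) v \<and>
           v (- diamond (- \<iota> p)) = True \<and> v (- diamond (\<iota> p)) = True)) \<and>
      (\<exists>v. valuation (expanded_context \<iota> W) v \<and>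
           v (- diamond (- \<iota> p)) = False \<and> v (- diamond (\<iota> p)) = False)) \<and>
     ((\<not> (\<exists>v. valuation (expanded_context \<iota> W) v \<and>
           v (diamond (\<iota> p)) = False \<and> v (diamond (- \<iota> p)) = False)) \<and>
      (\<exists>v. valuation (expanded_context \<iota> W) v \<and>
           v (diamond (\<iota> p)) = True \<and> v (diamond (- \<iota> p)) = True)) \<and>
     (\<forall>v. valuation (expanded_context \<iota> W) v \<longrightarrow>
        (v (- diamond (- \<iota> p)) = True \<longrightarrow> v (diamond (\<iota> p)) = True) \<and>
        (v (diamond (\<iota> p)) = False \<longrightarrow> v (- diamond (- \<iota> p)) = False) \<and>
        (v (- diamond (\<iota> p)) = True \<longrightarrow> v (diamond (- \<iota> p)) = True) \<and>
        (v (diamond (- \<iota> p)) = False \<longrightarrow> v (- diamond (\<iota> p)) = False)) \<and>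
     (\<forall>v. valuation (expanded_context \<iota> W) v \<longrightarrow>
        ((v (diamond (\<iota> p)) = True \<and> v (- diamond (\<iota> p)) = False) \<or>
         (v (diamond (\<iota> p)) = False \<and> v (- diamond (\<iota> p)) = True)) \<and>
        ((v (- diamond (- \<iota> p)) = True \<and> v (diamond (- \<iota> p)) = False) \<or>
         (v (- diamond (- \<iota> p)) = False \<and> v (diamond (- \<iota> p)) = True)))"
proof -
  let ?B = "expanded_context \<iota> W"
  have B: "boolean_subalgebra ?B"
    using assms by (intro boolean_subalgebra_expanded_context)
  have compl: "- x \<in> ?B" if "x \<in> ?B" for x
    using B that by (simp add: boolean_subalgebra_def)
  have p: "\<iota> p \<in> ?B"
    using \<open>p \<in> W\<close> by (simp add: expanded_context_def hull_inc)
  have dia: "diamond x \<in> ?B" for x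
    by (simp add: expanded_context_def hull_inc diamond_central)
  have v_compl: "v (- x) \<longleftrightarrow> \<not> v x" if "valuation ?B v" "x \<in> ?B" for v x
    using that by (simp add: valuation_def)
  have v_dia: "v (diamond x)" if "valuation ?B v" "x \<in> ?B" "v x" for v x
    using that(1,2) dia diamond_upper that(3) by (rule valuation_mono)
  \<comment> \<open>One of \<open>\<iota> p\<close> and \<open>- \<iota> p\<close> is true under
    \<open>v\<close>, hence so is its diamond. All universal claims about contraries, subcontraries
    and subalterns are forms of this disjunction.\<close>
  have cover: "v (diamond (\<iota> p)) \<or> v (diamond (- \<iota> p))" if "valuation ?B v" for v
    using v_dia[OF that p] v_dia[OF that compl[OF p]] v_compl[OF that p] by blast
  have "\<iota> p \<notin> center"
    using assms(1,2) by (blast dest: oml_embedding_center_reflect)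
  then have "diamond (\<iota> p) \<sqinter> diamond (- \<iota> p) \<noteq> \<bottom>"
    by (rule diamond_inf_diamond_compl_ne_bot)
  moreover have "diamond (\<iota> p) \<sqinter> diamond (- \<iota> p) \<in> ?B"
    using B dia by (simp add: boolean_subalgebra_def sublattice_def)
  ultimately obtain v where v: "valuation ?B v" "v (diamond (\<iota> p) \<sqinter> diamond (- \<iota> p))"
    using valuation_exists[OF B] by blast
  then have "v (diamond (\<iota> p))" "v (diamond (- \<iota> p))"
    using dia by (simp_all add: valuation_def)
  then have "\<exists>v. valuation ?B v \<and> v (diamond (\<iota> p)) \<and> v (diamond (- \<iota> p))"
    using v(1) by blast
  moreover have "v (- diamond x) \<longleftrightarrow> \<not> v (diamond x)" if "valuation ?B v" for v x
    using v_compl[OF that dia] .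
  ultimately show ?thesis
    \<comment> \<open>The congruence rule makes the conjunct \<open>valuation ?B v\<close> available
      when \<open>v (- diamond x)\<close> is rewritten under the existential quantifiers.\<close>
    using cover by (simp cong: conj_cong) blast
qed

end
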